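(* Let $l\ge 0$ and $k>0$ be integers, and let $a_0,a_1,\ldots,a_k$ and $b_0,b_1,\ldots,b_l$ be fixed integers with $b_l=1$ and $b_j=b_{l-j}$ for $j=0,1,\ldots,l$. For every integer $n$ with $2n>k$ let $$P_{2n+2l}(x)=x^{n+l}\left(\sum_{j=0}^l b_j\left(x^{n+j}+\frac{1}{x^{n+j}}\right)+a_0+\sum_{j=1}^k a_j\left(x^j+\frac{1}{x^j}\right)\right),$$ a monic reciprocal polynomial of degree $2n+2l$ with integer coefficients. Then $\lim_{n\to\infty} C(P_{2n+2l})$ exists.
   Context: For a polynomial $P$ of degree $d$, $C(P)$ denotes the number of complex zeros of $P$ (counted with multiplicity) whose modulus is different from $1$, divided by $d$.
   Formalization: The condition 2n>k alone does not make the expression a polynomial (l=0, k=3, n=2 gives a term a_3/x), nor monic; the formula is imposed only for 2n>k with n+l≥k, and the remark "monic reciprocal of degree 2n+2l" is not part of the theorem. Only finitely many n are affected, so the limit is the same. *)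

theory Defs
  imports Complex_Main "HOL-Computational_Algebra.Computational_Algebra"
begin

definition nonunimodular_frac :: "complex poly \<Rightarrow> real" where
  "nonunimodular_frac p = real (size {# z \<in># proots p. norm z \<noteq> 1 #}) / real (degree p)"

definition recip_form ::
    "(nat \<Rightarrow> int) \<Rightarrow> (nat \<Rightarrow> int) \<Rightarrow> nat \<Rightarrow> nat \<Rightarrow> nat \<Rightarrow> complex \<Rightarrow> complex" where
  "recip_form a b k l n x =
     x ^ (n + l) *
       ((\<Sum>j=0..l. of_int (b j) * (x ^ (n + j) + 1 / x ^ (n + j))) + of_int (a 0)
        + (\<Sum>j=1..k. of_int (a j) * (x ^ j + 1 / x ^ j)))"

text \<open>
  The function \<open>recip_form a b k l n\<close> is a Laurent polynomial in \<open>x\<close>; it may contain negative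
  powers of \<open>x\<close> when \<open>n + l < k\<close>, and its leading coefficient may differ from \<open>1\<close> when
  \<open>n + l \<le> k\<close>, even if \<open>2 * n > k\<close>. The lemmas below show that otherwise it is given, away from
  \<open>x = 0\<close>, by exactly one integer polynomial, and that this polynomial is monic and reciprocal
  of degree \<open>2 * n + 2 * l\<close>.
\<close>

definition recip_poly :: "(nat \<Rightarrow> int) \<Rightarrow> (nat \<Rightarrow> int) \<Rightarrow> nat \<Rightarrow> nat \<Rightarrow> nat \<Rightarrow> int poly" where
  "recip_poly a b k l n =
     (\<Sum>j=0..l. monom (b j) (n + l + (n + j)) + monom (b j) (l - j)) + monom (a 0) (n + l)
     + (\<Sum>j=1..k. monom (a j) (n + l + j) + monom (a j) (n + l - j))"

lemma map_poly_of_int_add: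
  "map_poly of_int (p + q :: int poly) = (map_poly of_int p + map_poly of_int q :: complex poly)"
  by (simp add: poly_eq_iff coeff_map_poly)

lemma poly_map_of_int_sum:
  "poly (map_poly of_int (\<Sum>i\<in>A. f i :: int poly)) (x :: complex)
     = (\<Sum>i\<in>A. poly (map_poly of_int (f i)) x)"
  by (induction A rule: infinite_finite_induct) (auto simp: map_poly_of_int_add)

lemma poly_recip_poly:
  assumes "k \<le> n + l" "x \<noteq> 0"
  shows "poly (map_poly of_int (recip_poly a b k l n)) x = recip_form a b k l n x"
proof -
  have 1: "x ^ (l - j) = x ^ (n + l) * (1 / x ^ (n + j))" if "j \<le> l" for j
    using that assms(2) by (simp add: field_simps flip: power_add)
  have 2: "x ^ (n + l - j) = x ^ (n + l) * (1 / x ^ j)" if "j \<le> k" for j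
    using that assms by (simp add: field_simps flip: power_add)
  have "(\<Sum>j=0..l. of_int (b j) * x ^ (n + l + (n + j)) + of_int (b j) * x ^ (l - j))
        = x ^ (n + l) * (\<Sum>j=0..l. of_int (b j) * (x ^ (n + j) + 1 / x ^ (n + j)))"
    unfolding sum_distrib_left
  proof (rule sum.cong)
    fix j assume "j \<in> {0..l}"
    hence "j \<le> l" by simp
    show "of_int (b j) * x ^ (n + l + (n + j)) + of_int (b j) * x ^ (l - j)
            = x ^ (n + l) * (of_int (b j) * (x ^ (n + j) + 1 / x ^ (n + j)))"
      unfolding 1[OF \<open>j \<le> l\<close>] power_add[of x "n + l"] by (simp add: algebra_simps)
  qed simp
  moreover
  have "(\<Sum>j=1..k. of_int (a j) * x ^ (n + l + j) + of_int (a j) * x ^ (n + l - j))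
        = x ^ (n + l) * (\<Sum>j=1..k. of_int (a j) * (x ^ j + 1 / x ^ j))"
    unfolding sum_distrib_left
  proof (rule sum.cong)
    fix j assume "j \<in> {1..k}"
    hence "j \<le> k" by simp
    show "of_int (a j) * x ^ (n + l + j) + of_int (a j) * x ^ (n + l - j)
            = x ^ (n + l) * (of_int (a j) * (x ^ j + 1 / x ^ j))"
      unfolding 2[OF \<open>j \<le> k\<close>] power_add[of x "n + l"] by (simp add: algebra_simps)
  qed simp
  ultimately show ?thesis
    unfolding recip_poly_def recip_form_def
    by (simp add: map_poly_of_int_add map_poly_monom poly_map_of_int_sum poly_monom distrib_left)
qed

lemma int_poly_eqI_nonzero:
  fixes p q :: "int poly"
  assumes "\<And>x::complex. x \<noteq> 0 \<Longrightarrow> poly (map_poly of_int p) x = poly (map_poly of_int q) x"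
  shows "p = q"
proof -
  define r :: "complex poly" where "r = map_poly of_int p - map_poly of_int q"
  have "- {0} \<subseteq> {x. poly r x = 0}"
    using assms by (auto simp: r_def)
  moreover have "infinite (- {0 :: complex})"
    by (simp add: infinite_UNIV_char_0 Compl_eq_Diff_UNIV)
  ultimately have "r = 0"
    using poly_roots_finite[of r] finite_subset by blast
  hence "map_poly of_int p = (map_poly of_int q :: complex poly)"
    by (simp add: r_def)
  thus ?thesis
    by (simp add: poly_eq_iff coeff_map_poly)
qed

lemma ex1_recip_poly:
  assumes "k \<le> n + l"
  shows "\<exists>!p :: int poly. \<forall>x. x \<noteq> 0 \<longrightarrow> poly (map_poly of_int p) x = recip_form a b k l n x"
  using poly_recip_poly[OF assms] int_poly_eqI_nonzero
  by (intro ex1I[of _ "recip_poly a b k l n"]) force+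

lemma recip_form_inverse:
  assumes "x \<noteq> 0"
  shows "x ^ (2 * n + 2 * l) * recip_form a b k l n (inverse x) = recip_form a b k l n x"
proof -
  have "x ^ (2 * n + 2 * l) * inverse x ^ (n + l) = x ^ (n + l)"
    using assms by (simp add: power_inverse power_add mult_2_right field_simps)
  moreover have "inverse x ^ i + 1 / inverse x ^ i = x ^ i + 1 / x ^ i" for i
    by (simp add: power_one_over inverse_eq_divide)
  ultimately show ?thesis
    by (simp only: recip_form_def mult.assoc[symmetric])
qed

lemma recip_poly_props:
  fixes p :: "int poly"
  assumes "k < n + l" "0 < n" "b l = 1"
    and p: "\<And>x::complex. x \<noteq> 0 \<Longrightarrow> poly (map_poly of_int p) x = recip_form a b k l n x"
  shows "degree p = 2 * n + 2 * l" "lead_coeff p = 1" "reflect_poly p = p"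
proof -
  have eq: "p = recip_poly a b k l n"
    using assms(1) p by (intro int_poly_eqI_nonzero) (simp add: poly_recip_poly)
  have c: "coeff p (2 * n + 2 * l) = 1"
  proof -
    have "(\<Sum>j=0..l. (if n + l + (n + j) = 2 * n + 2 * l then b j else 0)
             + (if l - j = 2 * n + 2 * l then b j else 0))
          = (\<Sum>j=0..l. if j = l then b j else 0)"
      using assms(2) by (intro sum.cong) auto
    moreover have "(\<Sum>j=1..k. (if n + l + j = 2 * n + 2 * l then a j else 0)
             + (if n + l - j = 2 * n + 2 * l then a j else 0)) = 0"
      using assms(1,2) by (intro sum.neutral) auto
    ultimately show ?thesis
      using assms(2,3) by (simp add: eq recip_poly_def coeff_sum coeff_monom)
  qed
  moreover have "degree p \<le> 2 * n + 2 * l"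
    unfolding eq recip_poly_def using assms(1)
    by (intro degree_add_le degree_sum_le) (auto intro!: degree_add_le order.trans[OF degree_monom_le])
  ultimately show deg: "degree p = 2 * n + 2 * l"
    using le_degree[of p "2 * n + 2 * l"] by simp
  with c show "lead_coeff p = 1" by simp
  show "reflect_poly p = p"
  proof (rule int_poly_eqI_nonzero)
    fix x :: complex assume x: "x \<noteq> 0"
    have "map_poly of_int (reflect_poly p) = (reflect_poly (map_poly of_int p) :: complex poly)"
      by (auto simp: poly_eq_iff coeff_map_poly coeff_reflect_poly degree_map_poly)
    thus "poly (map_poly of_int (reflect_poly p)) x = poly (map_poly of_int p) x"
      using x p recip_form_inverse[OF x, of n l a b k]
      by (simp add: poly_reflect_poly_nz degree_map_poly deg)
  qed
qed

end

theory Submission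
  imports Defs "HOL-Complex_Analysis.Complex_Analysis" "HOL-Real_Asymp.Real_Asymp"
begin

text \<open>
  On the unit circle the polynomial is, up to a unimodular factor, the real function
  \<open>2 * \<beta> t * cos ((n + l / 2) * t) + \<alpha> t\<close>, where \<open>\<alpha>\<close> and \<open>\<beta>\<close> are trigonometric polynomials
  independent of \<open>n\<close>. It has no zeros where \<open>\<bar>\<alpha>\<bar> > 2 * \<bar>\<beta>\<bar>\<close>. On a compact interval where
  \<open>\<bar>\<alpha>\<bar> < 2 * \<bar>\<beta>\<bar>\<close> its zeros are simple for large \<open>n\<close>, with exactly one in each interval between
  consecutive zeros of \<open>sin ((n + l / 2) * t)\<close>, so their number is \<open>n / \<pi>\<close> times the length of the
  interval, up to a bounded error. These two kinds of intervals are separated by finitely many points,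
  and Jensen's inequality bounds the number of zeros within \<open>\<delta>\<close> of such a point, counted with
  multiplicity, by a constant times \<open>\<delta> * n\<close>. The exception is
  \<open>\<alpha>\<^sup>2 = 4 * \<beta>\<^sup>2\<close> identically; then the polynomial divides, up to boundedly many factors,
  \<open>(x ^ (2 * n + l) - 1)\<^sup>2\<close>, and the limit is \<open>0\<close>.
\<close>

section \<open>Counting zeros with multiplicity: filtered multisets and Jensen's inequality\<close>

lemma size_filter_mset_mono:
  assumes "\<And>x. x \<in># M \<Longrightarrow> P x \<Longrightarrow> Q x"
  shows "size {#x \<in># M. P x#} \<le> size {#x \<in># M. Q x#}"
  using assms by (induction M) (auto intro: le_SucI)

lemma size_filter_mset_disj:
  assumes "\<And>x. \<not> (P x \<and> Q x)"
  shows "size {#x \<in># M. P x \<or> Q x#} = size {#x \<in># M. P x#} + size {#x \<in># M. Q x#}"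
  using assms by (induction M) auto

text \<open>Each factor \<open>x - z\<close> is traded for \<open>(R\<^sup>2 - cnj (z - x0) * (x - x0)) / R\<close>, which has the same
  modulus on the circle of radius \<open>R\<close> around \<open>x0\<close> but modulus \<open>R\<close> instead of \<open>dist x0 z\<close> at its centre.\<close>

lemma norm_center_le_of_reflected_zeros:
  fixes M :: "complex multiset"
  assumes "H holomorphic_on UNIV" and R: "0 < \<rho>" "\<rho> \<le> R"
    and "\<forall>z\<in>#M. dist x0 z \<le> \<rho>"
    and "\<And>x. dist x0 x = R \<Longrightarrow> norm (H x * (\<Prod>z\<in>#M. x - z)) \<le> K"
  shows "norm (H x0 * (\<Prod>z\<in>#M. x0 - z)) * (R / \<rho>) ^ size M \<le> K"
  using assms(1,4,5)
proof (induction M arbitrary: H)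
  case empty
  \<comment> \<open>The Cauchy estimate for the derivative of order 0 is the maximum modulus bound
    at the centre.\<close>
  have "norm ((deriv ^^ 0) H x0) \<le> fact 0 * K / R ^ 0"
  proof (rule Cauchy_inequality)
    show "H holomorphic_on ball x0 R" "continuous_on (cball x0 R) H"
      using empty(1) by (auto intro: holomorphic_on_subset holomorphic_on_imp_continuous_on)
    show "0 < R" using R by simp
    show "norm (H x) \<le> K" if "norm (x0 - x) = R" for x
      using empty(3)[of x] that by (simp add: dist_norm)
  qed
  thus ?case by simp
next
  case (add z M)
  define G where "G x = H x * ((of_real (R\<^sup>2) - cnj (z - x0) * (x - x0)) / of_real R)" for x
  have "0 < R" using R by simp
  have "norm (G x0 * (\<Prod>z\<in>#M. x0 - z)) * (R / \<rho>) ^ size M \<le> K"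
  proof (rule add.IH)
    show "G holomorphic_on UNIV"
      unfolding G_def using \<open>0 < R\<close> by (intro holomorphic_intros add) auto
    show "\<forall>z\<in>#M. dist x0 z \<le> \<rho>" using add by simp
    fix x assume x: "dist x0 x = R"
    have "of_real (R\<^sup>2) = (x - x0) * cnj (x - x0)"
      unfolding x[symmetric] dist_norm norm_minus_commute[of x0 x] by (rule complex_norm_square)
    hence "of_real (R\<^sup>2) - cnj (z - x0) * (x - x0) = (x - x0) * cnj (x - z)"
      by (simp add: algebra_simps)
    hence "norm ((of_real (R\<^sup>2) - cnj (z - x0) * (x - x0)) / of_real R) = norm (x - z)"
      using x \<open>0 < R\<close> by (simp only: norm_divide norm_mult complex_mod_cnj)
        (simp add: dist_norm norm_minus_commute)
    hence "norm (G x * (\<Prod>z\<in>#M. x - z)) = norm (H x * (\<Prod>z\<in>#add_mset z M. x - z))"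
      unfolding G_def norm_mult by (simp add: norm_mult)
    thus "norm (G x * (\<Prod>z\<in>#M. x - z)) \<le> K"
      using add.prems(3)[OF x] by simp
  qed
  moreover have "norm (G x0) = norm (H x0) * R"
    using \<open>0 < R\<close> by (simp add: G_def norm_mult norm_divide power2_eq_square)
  moreover have "norm (H x0 * (\<Prod>z\<in>#add_mset z M. x0 - z)) * (R / \<rho>) ^ size (add_mset z M)
     = (norm (x0 - z) / \<rho>) * (norm (H x0) * R * norm (\<Prod>z\<in>#M. x0 - z) * (R / \<rho>) ^ size M)"
    by (simp add: norm_mult)
  \<comment> \<open>Before the trade \<open>z\<close> contributes
    \<open>norm (x0 - z) * (R / \<rho>)\<close>, afterwards \<open>R\<close>; the quotient of the
    two is at most 1 because \<open>z\<close> lies within \<open>\<rho>\<close> of the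
    centre.\<close>
  moreover have "(norm (x0 - z) / \<rho>) * X \<le> X" if "X \<ge> 0" for X
    using that R add.prems(2) by (intro mult_left_le_one_le) (auto simp: dist_norm)
  ultimately show ?case
    using \<open>0 < R\<close> R by (smt (verit) mult_nonneg_nonneg norm_ge_zero norm_mult zero_le_divide_iff zero_le_power)
qed

text \<open>Jensen's inequality in exponential form. The zeros near \<open>x0\<close> are the ones
  reflected; the remaining zeros and the leading coefficient are absorbed into the entire factor
  \<open>H\<close>.\<close>

lemma jensen_bound_poly:
  fixes p :: "complex poly"
  assumes "0 < \<rho>" "\<rho> \<le> R"
    and K: "\<And>x. dist x0 x = R \<Longrightarrow> norm (poly p x) \<le> K"
  shows "norm (poly p x0) * (R / \<rho>) ^ size {#z \<in># proots p. dist x0 z \<le> \<rho>#} \<le> K"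
proof -
  define M where "M = {#z \<in># proots p. dist x0 z \<le> \<rho>#}"
  define M' where "M' = {#z \<in># proots p. \<not> dist x0 z \<le> \<rho>#}"
  have split: "proots p = M + M'"
    by (simp add: M_def M'_def flip: multiset_partition)
  define H where "H x = lead_coeff p * poly (\<Prod>z\<in>#M'. [:- z, 1:]) x" for x
  have prod: "poly (\<Prod>z\<in>#L. [:- z, 1:]) x = (\<Prod>z\<in>#L. x - z)" for L and x :: complex
    by (induction L) (auto simp: algebra_simps)
  have p: "poly p x = H x * (\<Prod>z\<in>#M. x - z)" for x
  proof -
    have "poly p x = poly (smult (lead_coeff p) (\<Prod>x\<in>#proots p. [:-x, 1:])) x"
      by (simp only: complex_poly_decompose_multiset)
    thus ?thesis
      by (simp add: split H_def prod mult_ac)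
  qed
  have "norm (H x0 * (\<Prod>z\<in>#M. x0 - z)) * (R / \<rho>) ^ size M \<le> K"
  proof (rule norm_center_le_of_reflected_zeros)
    show "H holomorphic_on UNIV"
      unfolding H_def by (intro holomorphic_intros)
    show "norm (H x * (\<Prod>z\<in>#M. x - z)) \<le> K" if "dist x0 x = R" for x
      using K[OF that] by (simp only: p)
  qed (use assms in \<open>auto simp: M_def\<close>)
  thus ?thesis by (simp add: p M_def)
qed

section \<open>Zeros of a perturbed cosine on an interval\<close>

text \<open>At a zero the cosine is at most \<open>q\<close> in modulus, and between two zeros in
  one cell it stays so. Hence the sine is at least \<open>sqrt (1 - q\<^sup>2)\<close> there, and
  the cosine changes faster than the Lipschitz function \<open>g\<close> can compensate.\<close>

lemma cos_perturbed_inj: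
  fixes g :: "real \<Rightarrow> real"
  assumes q: "\<bar>g s\<bar> \<le> q" "\<bar>g t\<bar> \<le> q" "q < 1"
    and lip: "\<bar>g s - g t\<bar> \<le> M * \<bar>s - t\<bar>"
    and N: "0 < N" "M < N * sqrt (1 - q\<^sup>2)"
    and zero: "cos (N * s) + g s = 0" "cos (N * t) + g t = 0"
    and floor: "\<lfloor>N * s / pi\<rfloor> = \<lfloor>N * t / pi\<rfloor>" and "s < t"
  shows False
proof -
  define m where "m = \<lfloor>N * s / pi\<rfloor>"
  \<comment> \<open>\<open>e\<close> is the sign \<open>(-1) ^ m\<close>, and \<open>u\<close>,
    \<open>v\<close> are the phases moved into \<open>{0..<pi}\<close>, where the cosine is
    decreasing and the sine nonnegative.\<close>
  define e where "e = cos (of_int m * pi)"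
  define u where "u = N * s - of_int m * pi"
  define v where "v = N * t - of_int m * pi"
  have sin0: "sin (of_int m * pi) = 0"
    by (simp add: sin_zero_iff_int2)
  have e: "\<bar>e\<bar> = 1"
    using sin_cos_squared_add[of "of_int m * pi"] sin0 by (simp add: e_def abs_square_eq_1)
  have "of_int m \<le> N * s / pi" "N * t / pi < of_int m + 1"
    using floor unfolding m_def by linarith+
  hence uv: "0 \<le> u" "v < pi" "u < v"
    using \<open>s < t\<close> N(1) by (auto simp: u_def v_def field_simps)
  have cs: "cos (N * s) = e * cos u" "cos (N * t) = e * cos v"
    using sin0 cos_add[of u "of_int m * pi"] cos_add[of v "of_int m * pi"]
    by (simp_all add: u_def v_def e_def)
  have "\<bar>cos u\<bar> \<le> q" "\<bar>cos v\<bar> \<le> q"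
  proof -
    have "\<bar>cos u\<bar> = \<bar>g s\<bar>" "\<bar>cos v\<bar> = \<bar>g t\<bar>"
      using zero e unfolding cs by (auto simp: abs_if split: if_splits)
    thus "\<bar>cos u\<bar> \<le> q" "\<bar>cos v\<bar> \<le> q" using q by simp_all
  qed
  obtain \<xi> where \<xi>: "u < \<xi>" "\<xi> < v" "cos v - cos u = (v - u) * (- sin \<xi>)"
    using MVT2[OF uv(3), of cos "\<lambda>x. - sin x"] by (auto intro: derivative_eq_intros)
  have "cos v \<le> cos \<xi>" "cos \<xi> \<le> cos u"
    using uv \<xi> by (auto intro!: cos_monotone_0_pi_le)
  hence "\<bar>cos \<xi>\<bar> \<le> \<bar>q\<bar>"
    using \<open>\<bar>cos u\<bar> \<le> q\<close> \<open>\<bar>cos v\<bar> \<le> q\<close> by linarith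
  hence "(cos \<xi>)\<^sup>2 \<le> q\<^sup>2"
    by (simp add: abs_le_square_iff)
  hence "sqrt (1 - q\<^sup>2) \<le> sqrt ((sin \<xi>)\<^sup>2)"
    by (simp add: sin_squared_eq)
  moreover have "0 \<le> sin \<xi>"
    using uv \<xi> by (intro sin_ge_zero) auto
  ultimately have "(v - u) * sqrt (1 - q\<^sup>2) \<le> (v - u) * sin \<xi>"
    using uv by (intro mult_left_mono) auto
  also have "\<dots> = cos u - cos v"
    using \<xi>(3) by simp
  also have "\<dots> \<le> \<bar>e * cos u - e * cos v\<bar>"
    using e by (simp add: abs_mult flip: right_diff_distrib)
  also have "\<dots> = \<bar>g s - g t\<bar>"
    using zero by (simp flip: cs)
  also have "\<dots> \<le> M * (t - s)"
    using lip \<open>s < t\<close> by simp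
  also have "\<dots> < N * sqrt (1 - q\<^sup>2) * (t - s)"
    using N \<open>s < t\<close> by simp
  also have "\<dots> = (v - u) * sqrt (1 - q\<^sup>2)"
    by (simp add: u_def v_def algebra_simps)
  finally show False by simp
qed

text \<open>At the two ends of the cell the cosine is 1 and -1 in some order, which outweighs
  \<open>g\<close>; the intermediate value theorem does the rest.\<close>

lemma cos_perturbed_ex:
  fixes g :: "real \<Rightarrow> real" and m :: int
  assumes N: "0 < N" and cont: "continuous_on {of_int m * pi / N..of_int (m + 1) * pi / N} g"
    and g: "\<And>t. t \<in> {of_int m * pi / N..of_int (m + 1) * pi / N} \<Longrightarrow> \<bar>g t\<bar> < 1"
  obtains t where "of_int m * pi / N < t" "t < of_int (m + 1) * pi / N"
    "cos (N * t) + g t = 0" "\<lfloor>N * t / pi\<rfloor> = m"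
proof -
  let ?c = "of_int m * pi / N" and ?d = "of_int (m + 1) * pi / N"
  \<comment> \<open>The sign \<open>(-1) ^ m\<close>. Multiplication by it makes the function
    nonnegative on the left and nonpositive on the right for either parity of
    \<open>m\<close>.\<close>
  define e where "e = cos (of_int m * pi)"
  have sin0: "sin (of_int m * pi) = 0"
    by (simp add: sin_zero_iff_int2)
  have e: "e = 1 \<or> e = -1"
    using sin_cos_squared_add[of "of_int m * pi"] sin0 by (simp add: e_def power2_eq_1_iff)
  have e1: "cos (N * ?c) = e" "cos (N * ?d) = - e"
  proof -
    have "N * ?c = of_int m * pi" "N * ?d = of_int m * pi + pi"
      using N by (simp_all add: distrib_right)
    thus "cos (N * ?c) = e" "cos (N * ?d) = - e"
      by (simp_all only: e_def cos_periodic_pi)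
  qed
  have "?c \<le> ?d" using N by (simp add: divide_simps)
  hence gcd: "\<bar>g ?c\<bar> < 1" "\<bar>g ?d\<bar> < 1" by (auto intro!: g)
  have "\<exists>t. ?c \<le> t \<and> t \<le> ?d \<and> e * (cos (N * t) + g t) = 0"
  proof (rule IVT2')
    show "e * (cos (N * ?d) + g ?d) \<le> 0" "0 \<le> e * (cos (N * ?c) + g ?c)"
      unfolding e1 using e gcd by auto
    show "continuous_on {?c..?d} (\<lambda>t. e * (cos (N * t) + g t))"
      by (intro continuous_intros cont)
  qed fact
  then obtain t where t: "?c \<le> t" "t \<le> ?d" "cos (N * t) + g t = 0"
    using e by auto
  have "t \<noteq> ?c" "t \<noteq> ?d"
    using t(3) e1 e gcd by auto
  hence t': "?c < t" "t < ?d" using t by auto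
  hence "\<lfloor>N * t / pi\<rfloor> = m"
    using N by (intro floor_unique) (auto simp: field_simps)
  thus ?thesis using that t' t(3) by blast
qed

text \<open>The cell index \<open>\<phi>\<close> is injective on the zeros, so counting zeros
  becomes counting integers: every cell inside the interval is hit, and only cells meeting it can
  be.\<close>

lemma card_zeros_cos_perturbed:
  fixes g :: "real \<Rightarrow> real"
  assumes "c \<le> d" and cont: "continuous_on {c..d} g"
    and q: "\<And>t. t \<in> {c..d} \<Longrightarrow> \<bar>g t\<bar> \<le> q" "q < 1"
    and lip: "\<And>s t. s \<in> {c..d} \<Longrightarrow> t \<in> {c..d} \<Longrightarrow> \<bar>g s - g t\<bar> \<le> M * \<bar>s - t\<bar>"
    and N: "0 < N" "M < N * sqrt (1 - q\<^sup>2)"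
  defines "Z \<equiv> {t \<in> {c..<d}. cos (N * t) + g t = 0}"
  shows "finite Z" "\<bar>real (card Z) - N * (d - c) / pi\<bar> \<le> 2"
proof -
  define \<phi> where "\<phi> t = \<lfloor>N * t / pi\<rfloor>" for t
  have inj: "inj_on \<phi> Z"
  proof (rule linorder_inj_onI)
    fix s t assume st: "s < t" "s \<in> Z" "t \<in> Z"
    show "\<phi> s \<noteq> \<phi> t"
    proof
      assume eq: "\<phi> s = \<phi> t"
      show False
        using cos_perturbed_inj[of g s q t M N] st eq q lip[of s t] N by (auto simp: Z_def \<phi>_def)
    qed
  qed auto
  have sub: "\<phi> ` Z \<subseteq> {\<lfloor>N * c / pi\<rfloor>..\<lfloor>N * d / pi\<rfloor>}"
    using N by (auto simp: Z_def \<phi>_def intro!: floor_mono divide_right_mono)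
  thus fin: "finite Z"
    using inj finite_imageD finite_subset by blast
  have "card Z = card (\<phi> ` Z)"
    using inj by (simp add: card_image)
  also have "\<dots> \<le> card {\<lfloor>N * c / pi\<rfloor>..\<lfloor>N * d / pi\<rfloor>}"
    using sub by (intro card_mono) auto
  finally have "card Z \<le> nat (\<lfloor>N * d / pi\<rfloor> + 1 - \<lfloor>N * c / pi\<rfloor>)" by simp
  moreover have "N * c / pi \<le> N * d / pi"
    using N \<open>c \<le> d\<close> by (intro divide_right_mono) auto
  ultimately have upper: "real (card Z) \<le> N * d / pi - N * c / pi + 2"
    by linarith
  \<comment> \<open>A cell with index in this range lies wholly inside \<open>{c..d}\<close>, and
    its zero is strictly below \<open>d\<close>, hence in the half-open \<open>Z\<close>. Rounding
    costs at most 1 at either end, which gives the error 2.\<close>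
  have "{\<lceil>N * c / pi\<rceil>..<\<lfloor>N * d / pi\<rfloor>} \<subseteq> \<phi> ` Z"
  proof
    fix m assume m: "m \<in> {\<lceil>N * c / pi\<rceil>..<\<lfloor>N * d / pi\<rfloor>}"
    hence "N * c / pi \<le> of_int m" "of_int (m + 1) \<le> N * d / pi"
      by (auto simp: ceiling_le_iff) linarith
    hence cd: "c \<le> of_int m * pi / N" "of_int (m + 1) * pi / N \<le> d"
      using N by (auto simp: field_simps)
    obtain t where t: "of_int m * pi / N < t" "t < of_int (m + 1) * pi / N"
      "cos (N * t) + g t = 0" "\<lfloor>N * t / pi\<rfloor> = m"
    proof (rule cos_perturbed_ex[of N m g])
      show "continuous_on {of_int m * pi / N..of_int (m + 1) * pi / N} g"
        by (rule continuous_on_subset[OF cont]) (use cd in auto)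
      show "\<bar>g t\<bar> < 1" if "t \<in> {of_int m * pi / N..of_int (m + 1) * pi / N}" for t
        using q(1)[of t] q(2) that cd by auto
    qed (use N in auto)
    hence "t \<in> Z" using cd by (auto simp: Z_def)
    thus "m \<in> \<phi> ` Z" using t by (auto simp: \<phi>_def)
  qed
  hence "card {\<lceil>N * c / pi\<rceil>..<\<lfloor>N * d / pi\<rfloor>} \<le> card (\<phi> ` Z)"
    using fin by (intro card_mono) auto
  hence "nat (\<lfloor>N * d / pi\<rfloor> - \<lceil>N * c / pi\<rceil>) \<le> card Z"
    using inj by (simp add: card_image)
  hence "N * d / pi - N * c / pi - 2 \<le> real (card Z)"
    by linarith
  with upper show "\<bar>real (card Z) - N * (d - c) / pi\<bar> \<le> 2"
    by (auto simp: right_diff_distrib diff_divide_distrib)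
qed

section \<open>The polynomial family and its real form on the unit circle\<close>

locale reciprocal_family =
  fixes a b :: "nat \<Rightarrow> int" and k l :: nat
  assumes b_top: "b l = 1" and b_sym: "\<And>j. j \<le> l \<Longrightarrow> b j = b (l - j)"
begin

definition B :: "complex poly" where
  "B = (\<Sum>j=0..l. monom (of_int (b j)) j)"

text \<open>With \<open>F x\<close> for the part of the Laurent polynomial built from the \<open>a j\<close>, the polynomial \<open>A\<close> is
  \<open>x ^ k * F x\<close>; the real functions \<open>\<alpha>\<close> and \<open>\<beta>\<close> are \<open>F (cis t)\<close> and \<open>B (cis t) * cis (- l * t / 2)\<close>.
  The polynomial \<open>D\<close> below vanishes at \<open>cis t\<close> exactly when \<open>\<bar>\<alpha> t\<bar> = 2 * \<bar>\<beta> t\<bar>\<close>.\<close>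

definition A :: "complex poly" where
  "A = monom (of_int (a 0)) k
     + (\<Sum>j=1..k. monom (of_int (a j)) (k + j) + monom (of_int (a j)) (k - j))"

definition \<beta> :: "real \<Rightarrow> real" where
  "\<beta> t = (\<Sum>j=0..l. of_int (b j) * cos ((real j - real l / 2) * t))"

definition \<alpha> :: "real \<Rightarrow> real" where
  "\<alpha> t = of_int (a 0) + (\<Sum>j=1..k. of_int (a j) * (2 * cos (real j * t)))"

definition p :: "nat \<Rightarrow> complex poly" where
  "p n = map_poly of_int (recip_poly a b k l n)"

definition D :: "complex poly" where
  "D = A\<^sup>2 * monom 1 l - smult 4 (monom 1 (2 * k) * B\<^sup>2)"

lemma B_nonzero: "B \<noteq> 0"
proof -
  have "coeff B l = 1"
    by (simp add: B_def coeff_sum coeff_monom if_distrib[of of_int] b_top cong: if_cong)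
  thus ?thesis by auto
qed

lemma degree_B: "degree B \<le> l"
  unfolding B_def by (intro degree_sum_le) (auto intro: order.trans[OF degree_monom_le])

lemma p_eq:
  "p n = (\<Sum>j=0..l. monom (of_int (b j)) (n + l + (n + j)) + monom (of_int (b j)) (l - j))
     + monom (of_int (a 0)) (n + l)
     + (\<Sum>j=1..k. monom (of_int (a j)) (n + l + j) + monom (of_int (a j)) (n + l - j))"
proof -
  have "map_poly of_int (\<Sum>i\<in>I. f i :: int poly) = (\<Sum>i\<in>I. map_poly of_int (f i) :: complex poly)"
    for I :: "nat set" and f
    by (induction I rule: infinite_finite_induct) (auto simp: map_poly_of_int_add)
  thus ?thesis
    by (simp add: p_def recip_poly_def map_poly_of_int_add map_poly_monom)
qed

text \<open>Multiplying by \<open>x ^ k\<close> clears the denominators of the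
  \<open>a\<close>-part, so that \<open>n\<close> survives only in the exponents of two monomials.
  The symmetry of \<open>b\<close> identifies the low-order half with \<open>B\<close>
  again.\<close>

lemma monom_mult_p:
  assumes "k \<le> n + l"
  shows "monom 1 k * p n = monom 1 k * B * (monom 1 (2 * n + l) + 1) + monom 1 (n + l) * A"
proof -
  have 1: "(\<Sum>j=0..l. monom (of_int (b j)) (k + (n + l + (n + j))))
      = monom 1 k * B * monom (1::complex) (2 * n + l)"
  proof -
    have "k + (n + l + (n + j)) = k + j + (2 * n + l)" for j by simp
    thus ?thesis by (simp only: B_def sum_distrib_left sum_distrib_right mult_monom mult_1_left mult_1_right)
  qed
  have "(\<Sum>j=0..l. monom (of_int (b j)) (k + (l - j)))
      = (\<Sum>j=0..l. monom (of_int (b (l - j))) (k + (l - j)) :: complex poly)"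
    by (intro sum.cong refl) (metis b_sym atLeastAtMost_iff)
  also have "\<dots> = (\<Sum>j=0..l. monom (of_int (b j)) (k + j))"
    using sum.atLeastAtMost_rev[of "\<lambda>j. monom (of_int (b j)) (k + j) :: complex poly" 0 l] by simp
  also have "\<dots> = monom 1 k * B"
    by (simp add: B_def sum_distrib_left mult_monom)
  finally have 2: "(\<Sum>j=0..l. monom (of_int (b j)) (k + (l - j))) = monom 1 k * B" .
  \<comment> \<open>Both truncated subtractions are exact, since
    \<open>j \<le> k \<le> n + l\<close>.\<close>
  have 3: "(\<Sum>j=1..k. monom (of_int (a j)) (k + (n + l - j)))
     = (\<Sum>j=1..k. monom (of_int (a j)) (n + l + (k - j)) :: complex poly)"
    using assms by (intro sum.cong) (auto simp: add.commute)
  show ?thesis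
    unfolding p_eq A_def distrib_left sum_distrib_left mult_monom mult_1_left sum.distrib 1 2 3
    by (simp add: add_ac)
qed

text \<open>After the middle phase is factored out, the indices \<open>j\<close> and
  \<open>l - j\<close> carry equal coefficients and opposite angles, so the sine sum
  \<open>\<sigma>\<close> cancels.\<close>

lemma poly_B_cis: "poly B (cis t) = cis (real l / 2 * t) * of_real (\<beta> t)"
proof -
  define \<sigma> where "\<sigma> = (\<Sum>j=0..l. of_int (b j) * sin ((real j - real l / 2) * t))"
  have "\<sigma> = (\<Sum>j=0..l. of_int (b (l - j)) * sin ((real (l - j) - real l / 2) * t))"
    unfolding \<sigma>_def
    using sum.atLeastAtMost_rev[of "\<lambda>j. of_int (b j) * sin ((real j - real l / 2) * t)" 0 l] by simp
  also have "\<dots> = (\<Sum>j=0..l. - (of_int (b j) * sin ((real j - real l / 2) * t)))"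
  proof (rule sum.cong)
    fix j assume "j \<in> {0..l}"
    hence j: "j \<le> l" by simp
    have "(real (l - j) - real l / 2) * t = - ((real j - real l / 2) * t)"
      using j by (simp add: of_nat_diff algebra_simps)
    thus "of_int (b (l - j)) * sin ((real (l - j) - real l / 2) * t)
        = - (of_int (b j) * sin ((real j - real l / 2) * t))"
      using b_sym[OF j, symmetric] by simp
  qed simp
  also have "\<dots> = - \<sigma>" by (simp add: \<sigma>_def sum_negf)
  finally have \<sigma>: "\<sigma> = 0" by simp
  have "poly B (cis t) = (\<Sum>j=0..l. of_int (b j) * cis (real j * t))"
    by (simp add: B_def poly_sum poly_monom Complex.DeMoivre)
  also have "\<dots> = cis (real l / 2 * t) * (\<Sum>j=0..l. of_int (b j) * cis ((real j - real l / 2) * t))"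
    unfolding sum_distrib_left
    by (intro sum.cong) (auto simp: mult.left_commute[of "cis _"] cis_mult algebra_simps)
  also have "(\<Sum>j=0..l. of_int (b j) * cis ((real j - real l / 2) * t)) = Complex (\<beta> t) \<sigma>"
    by (simp add: complex_eq_iff \<beta>_def \<sigma>_def Re_sum Im_sum)
  finally show ?thesis by (simp add: \<sigma> complex_of_real_def)
qed

lemma poly_A_cis: "poly A (cis t) = cis (real k * t) * of_real (\<alpha> t)"
proof -
  have cis2: "cis x + cis (- x) = of_real (2 * cos x)" for x
    by (simp add: complex_eq_iff)
  have "poly A (cis t) = of_int (a 0) * cis (real k * t)
      + (\<Sum>j=1..k. of_int (a j) * (cis (real (k + j) * t) + cis (real (k - j) * t)))"
    by (simp add: A_def poly_sum poly_monom Complex.DeMoivre distrib_left)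
  also have "(\<Sum>j=1..k. of_int (a j) * (cis (real (k + j) * t) + cis (real (k - j) * t)))
     = (\<Sum>j=1..k. cis (real k * t) * (of_int (a j) * of_real (2 * cos (real j * t))))"
  proof (rule sum.cong)
    fix j assume "j \<in> {1..k}"
    hence "cis (real (k + j) * t) + cis (real (k - j) * t)
        = cis (real k * t) * (cis (real j * t) + cis (- (real j * t)))"
      by (simp add: cis_mult of_nat_diff algebra_simps)
    thus "of_int (a j) * (cis (real (k + j) * t) + cis (real (k - j) * t))
        = cis (real k * t) * (of_int (a j) * of_real (2 * cos (real j * t)))"
      by (simp only: cis2 mult_ac)
  qed simp
  finally show ?thesis
    by (simp add: \<alpha>_def distrib_left sum_distrib_left mult_ac)
qed

text \<open>The factor \<open>x ^ (2 * n + l) + 1\<close> becomes a phase times twice a cosine, and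
  this phase combines with that of \<open>B\<close> to the one carried by the \<open>A\<close>
  term.\<close>

lemma poly_p_cis:
  assumes "k \<le> n + l"
  shows "poly (p n) (cis t) = cis (real (n + l) * t)
           * of_real (2 * \<beta> t * cos ((real n + real l / 2) * t) + \<alpha> t)"
proof -
  let ?N = "real n + real l / 2"
  have c2: "cis (real (2 * n + l) * t) + 1 = cis (?N * t) * of_real (2 * cos (?N * t))"
  proof -
    have "cis (?N * t) * (cis (?N * t) + cis (- (?N * t))) = cis (real (2 * n + l) * t) + 1"
      by (simp add: distrib_left cis_mult) (simp add: algebra_simps)
    moreover have "cis (?N * t) + cis (- (?N * t)) = of_real (2 * cos (?N * t))"
      by (simp add: complex_eq_iff)
    ultimately show ?thesis by simp
  qed
  have "cis (real k * t) * poly (p n) (cis t) = poly (monom 1 k * p n) (cis t)"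
    by (simp add: poly_monom Complex.DeMoivre)
  also have "\<dots> = cis (real k * t) * (cis (real l / 2 * t) * of_real (\<beta> t))
      * (cis (real (2 * n + l) * t) + 1) + cis (real (n + l) * t) * (cis (real k * t) * of_real (\<alpha> t))"
    unfolding monom_mult_p[OF assms] by (simp add: poly_monom Complex.DeMoivre poly_B_cis poly_A_cis)
  also have "\<dots> = cis (real k * t) * ((cis (real l / 2 * t) * cis (?N * t)) * of_real (2 * \<beta> t * cos (?N * t))
      + cis (real (n + l) * t) * of_real (\<alpha> t))"
    unfolding c2 by (simp add: algebra_simps)
  also have "cis (real l / 2 * t) * cis (?N * t) = cis (real (n + l) * t)"
    unfolding cis_mult by (simp add: algebra_simps)
  finally have "poly (p n) (cis t) = cis (real (n + l) * t) * of_real (2 * \<beta> t * cos (?N * t))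
      + cis (real (n + l) * t) * of_real (\<alpha> t)"
    by (simp only: mult_cancel_left cis_neq_zero) simp
  thus ?thesis by (simp add: distrib_left)
qed

lemma poly_D_cis: "poly D (cis t) = cis (real (2 * k + l) * t) * of_real ((\<alpha> t)\<^sup>2 - (2 * \<beta> t)\<^sup>2)"
proof -
  have "cis (real l / 2 * t) ^ 2 = cis (real l * t)" "cis (real k * t) ^ 2 = cis (real (2 * k) * t)"
    unfolding Complex.DeMoivre by (simp_all add: mult.assoc)
  note squares = this
  have "poly D (cis t) = (cis (real k * t) * of_real (\<alpha> t))\<^sup>2 * cis (real l * t)
      - 4 * (cis (real (2 * k) * t) * (cis (real l / 2 * t) * of_real (\<beta> t))\<^sup>2)"
    by (simp add: D_def poly_monom poly_A_cis poly_B_cis Complex.DeMoivre)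
  also have "\<dots> = cis (real (2 * k) * t) * cis (real l * t) * of_real ((\<alpha> t)\<^sup>2 - (2 * \<beta> t)\<^sup>2)"
    unfolding power_mult_distrib squares by (simp add: algebra_simps)
  also have "cis (real (2 * k) * t) * cis (real l * t) = cis (real (2 * k + l) * t)"
    unfolding cis_mult by (simp add: algebra_simps)
  finally show ?thesis .
qed

end

section \<open>Few zeros near a given point of the unit circle\<close>

lemma norm_cis_diff_le: "norm (cis s - cis t) \<le> \<bar>s - t\<bar>"
proof -
  have "cis s - cis t = cis t * (exp (\<i> * of_real (s - t)) - 1)"
    by (simp only: right_diff_distrib cis_mult cis_conv_exp[symmetric]) (simp add: cis_mult)
  hence "norm (cis s - cis t) = 2 * \<bar>sin ((s - t) / 2)\<bar>"
    by (simp only: norm_mult norm_cis mult_1_left dist_exp_i_1)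
  also have "\<dots> \<le> \<bar>s - t\<bar>"
    using abs_sin_x_le_abs_x[of "(s - t) / 2"] by simp
  finally show ?thesis .
qed

context reciprocal_family
begin

text \<open>Bounds the sum of the moduli of the coefficients of \<open>p n\<close> uniformly in
  \<open>n\<close>, so it costs only a constant in Jensen's inequality.\<close>

definition K :: real where
  "K = (\<Sum>j=0..l. 2 * \<bar>of_int (b j)\<bar>) + \<bar>of_int (a 0)\<bar> + (\<Sum>j=1..k. 2 * \<bar>of_int (a j)\<bar>)"

lemma norm_poly_p_le:
  assumes "k \<le> n + l" "norm x \<le> y" "1 \<le> y"
  shows "norm (poly (p n) x) \<le> K * y ^ (2 * n + 2 * l)"
proof -
  have mono: "norm (of_int c * x ^ i) \<le> \<bar>of_int c\<bar> * y ^ (2 * n + 2 * l)" if "i \<le> 2 * n + 2 * l" for c :: int and i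
  proof -
    have "norm x ^ i \<le> y ^ i" using assms by (intro power_mono) auto
    also have "\<dots> \<le> y ^ (2 * n + 2 * l)" using assms that by (intro power_increasing) auto
    finally show ?thesis by (auto simp: norm_mult norm_power intro!: mult_left_mono)
  qed
  show ?thesis
    unfolding p_eq K_def distrib_right sum_distrib_right poly_add poly_sum poly_monom
  proof (intro norm_triangle_mono sum_norm_le)
    show "norm (of_int (b j) * x ^ (n + l + (n + j)) + of_int (b j) * x ^ (l - j))
        \<le> 2 * \<bar>real_of_int (b j)\<bar> * y ^ (2 * n + 2 * l)" if "j \<in> {0..l}" for j
      using norm_triangle_mono[OF mono[of "n + l + (n + j)" "b j"] mono[of "l - j" "b j"]] that
      by (auto simp: mult.assoc)
    show "norm (of_int (a j) * x ^ (n + l + j) + of_int (a j) * x ^ (n + l - j))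
        \<le> 2 * \<bar>real_of_int (a j)\<bar> * y ^ (2 * n + 2 * l)" if "j \<in> {1..k}" for j
      using norm_triangle_mono[OF mono[of "n + l + j" "a j"] mono[of "n + l - j" "a j"]] that assms(1)
      by (auto simp: mult.assoc)
    show "norm (of_int (a 0) * x ^ (n + l)) \<le> \<bar>real_of_int (a 0)\<bar> * y ^ (2 * n + 2 * l)"
      by (rule mono) simp
  qed
qed

text \<open>Relative to \<open>x ^ (2 * n)\<close>, the two other terms decay like
  \<open>(1 / x\<^sup>2) ^ n\<close> and \<open>(1 / x) ^ n\<close>.\<close>

lemma poly_p_asymp:
  assumes "norm x > 1"
  shows "(\<lambda>n. poly (p n) x / x ^ (2 * n)) \<longlonglongrightarrow> x ^ l * poly B x"
proof (rule Lim_transform_eventually)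
  have [simp]: "x \<noteq> 0" using assms by auto
  have "norm (1 / x) < 1" "norm (1 / x\<^sup>2) < 1"
    using assms by (simp_all add: norm_divide norm_power divide_simps one_less_power)
  hence "(\<lambda>n. x ^ l * poly B x + poly B x * (1 / x\<^sup>2) ^ n + x ^ l * poly A x / x ^ k * (1 / x) ^ n)
      \<longlonglongrightarrow> x ^ l * poly B x + poly B x * 0 + x ^ l * poly A x / x ^ k * 0"
    by (intro tendsto_intros LIMSEQ_power_zero)
  thus "(\<lambda>n. x ^ l * poly B x + poly B x * (1 / x\<^sup>2) ^ n + x ^ l * poly A x / x ^ k * (1 / x) ^ n)
      \<longlonglongrightarrow> x ^ l * poly B x" by simp
  show "\<forall>\<^sub>F n in sequentially. x ^ l * poly B x + poly B x * (1 / x\<^sup>2) ^ n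
      + x ^ l * poly A x / x ^ k * (1 / x) ^ n = poly (p n) x / x ^ (2 * n)"
    using eventually_ge_at_top[of k]
  proof eventually_elim
    case (elim n)
    have "poly (monom 1 k * p n) x
        = x ^ k * poly B x * (x ^ (2 * n + l) + 1) + x ^ (n + l) * poly A x"
      using elim by (subst monom_mult_p) (auto simp: poly_monom)
    hence "poly (p n) x = poly B x * (x ^ (2 * n + l) + 1) + x ^ (n + l) * poly A x / x ^ k"
      by (simp add: poly_monom field_simps)
    moreover have "x ^ (2 * n) = x ^ n * x ^ n"
      by (simp add: mult_2 power_add)
    ultimately show ?case
      by (simp add: power_add power_divide flip: power_mult) (simp add: field_simps)
  qed
qed

text \<open>Jensen's inequality on discs of radii \<open>2 * r\<close> and \<open>4 * r\<close> about \<open>(1 + r) * cis c\<close>: at that centre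
  the term \<open>x ^ (2 * n + l) * B x\<close> dominates \<open>p n\<close>, which gives the lower bound.\<close>

lemma eventually_zeros_near_point_le:
  assumes "\<epsilon> > 0"
  shows "\<exists>\<delta>>0. \<forall>\<^sub>F n in sequentially.
    real (size {#z \<in># proots (p n). z \<in> cis ` {c - \<delta>..c + \<delta>}#}) \<le> \<epsilon> * real n"
proof -
  \<comment> \<open>\<open>B\<close> has finitely many zeros, so arbitrarily small \<open>r\<close>
    keep the centre \<open>X r\<close> off them. The 17 is 16 from the growth rate obtained at the
    end, plus 1 to absorb \<open>2 * ln C\<close>.\<close>
  define X where "X r = of_real (1 + r) * cis c" for r
  have "inj X" by (auto simp: inj_def X_def)
  hence "finite (X -` {z. poly B z = 0})"
    using poly_roots_finite[OF B_nonzero] by (intro finite_vimageI)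
  moreover have "infinite {0<..<\<epsilon> / 17}" using assms by simp
  ultimately have "\<not> {0<..<\<epsilon> / 17} \<subseteq> X -` {z. poly B z = 0}"
    using finite_subset by blast
  then obtain r where "r \<in> {0<..<\<epsilon> / 17}" "r \<notin> X -` {z. poly B z = 0}"
    by blast
  hence r: "0 < r" "r < \<epsilon> / 17" "poly B (X r) \<noteq> 0"
    by auto
  define x0 where "x0 = X r"
  have norm_x0: "norm x0 = 1 + r"
    using r by (simp add: x0_def X_def norm_mult del: of_real_add)
  define \<kappa> where "\<kappa> = norm (x0 ^ l * poly B x0) / 2"
  have \<kappa>: "\<kappa> > 0" using r norm_x0 by (auto simp: \<kappa>_def x0_def[symmetric])
  have "(\<lambda>n. norm (poly (p n) x0 / x0 ^ (2 * n))) \<longlonglongrightarrow> norm (x0 ^ l * poly B x0)"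
    using norm_x0 r by (intro tendsto_norm poly_p_asymp) auto
  hence ev: "\<forall>\<^sub>F n in sequentially. norm (poly (p n) x0 / x0 ^ (2 * n)) > \<kappa>"
    by (rule order_tendstoD) (use \<kappa> in \<open>auto simp: \<kappa>_def\<close>)
  define C where "C = K * (1 + 5 * r) ^ (2 * l) / \<kappa>"
  have "filterlim (\<lambda>n. r * real n) at_top sequentially"
    using r by (intro filterlim_tendsto_pos_mult_at_top[OF tendsto_const] filterlim_real_sequentially)
  hence ev2: "\<forall>\<^sub>F n in sequentially. r * real n \<ge> 2 * ln C"
    by (simp add: filterlim_at_top)
  have "\<forall>\<^sub>F n in sequentially.
    real (size {#z \<in># proots (p n). z \<in> cis ` {c - r..c + r}#}) \<le> \<epsilon> * real n"
    using ev ev2 eventually_ge_at_top[of k]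
  proof eventually_elim
    case (elim n)
    define m where "m = size {#z \<in># proots (p n). z \<in> cis ` {c - r..c + r}#}"
    define m' where "m' = size {#z \<in># proots (p n). dist x0 z \<le> 2 * r#}"
    have "dist x0 (cis t) \<le> 2 * r" if "t \<in> {c - r..c + r}" for t
    proof -
      have "x0 - cis c = of_real r * cis c"
        by (simp add: x0_def X_def algebra_simps)
      hence "dist x0 (cis c) = r"
        using r by (simp add: dist_norm norm_mult)
      moreover have "dist (cis c) (cis t) \<le> r"
        using norm_cis_diff_le[of c t] that by (auto simp: dist_norm)
      ultimately show ?thesis
        using dist_triangle[of x0 "cis t" "cis c"] by simp
    qed
    hence "m \<le> m'"
      unfolding m_def m'_def by (intro size_filter_mset_mono) auto
    have "norm (poly (p n) x0) * (4 * r / (2 * r)) ^ m' \<le> K * (1 + 5 * r) ^ (2 * n + 2 * l)"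
      unfolding m'_def
    proof (rule jensen_bound_poly)
      fix x assume "dist x0 x = 4 * r"
      hence "norm x \<le> 1 + 5 * r"
        using norm_x0 norm_triangle_ineq2[of x x0] by (simp add: dist_norm norm_minus_commute)
      thus "norm (poly (p n) x) \<le> K * (1 + 5 * r) ^ (2 * n + 2 * l)"
        using r elim by (intro norm_poly_p_le) auto
    qed (use r in auto)
    hence J: "norm (poly (p n) x0) * 2 ^ m' \<le> K * (1 + 5 * r) ^ (2 * n + 2 * l)"
      using r by simp
    have "\<kappa> * (1 + r) ^ (2 * n) * 2 ^ m' \<le> norm (poly (p n) x0) * 2 ^ m'"
      using elim(1) r norm_x0 by (intro mult_right_mono) (auto simp: norm_divide norm_power field_simps)
    also note J
    also have "K * (1 + 5 * r) ^ (2 * n + 2 * l) = C * \<kappa> * (1 + 5 * r) ^ (2 * n)"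
      using \<kappa> by (simp add: C_def power_add)
    finally have "(1 + r) ^ (2 * n) * 2 ^ m' \<le> C * (1 + 5 * r) ^ (2 * n)"
      using \<kappa> by (simp add: mult.assoc mult.left_commute[of \<kappa>])
    hence "2 ^ m' \<le> C * ((1 + 5 * r) / (1 + r)) ^ (2 * n)"
      using r by (simp add: power_divide field_simps)
    \<comment> \<open>The sign of \<open>C\<close> is read off the inequality itself: its left side
      is positive.\<close>
    moreover have "(0::real) < 2 ^ m'" by simp
    ultimately have "0 < C * ((1 + 5 * r) / (1 + r)) ^ (2 * n)" by linarith
    hence C: "C > 0"
      using r by (simp add: zero_less_mult_iff)
    have "2 ^ m' \<le> C * ((1 + 5 * r) / (1 + r)) ^ (2 * n)" by fact
    \<comment> \<open>The exponent \<open>2 * n\<close> turns the rate \<open>4 * r\<close> into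
      \<open>8 * r\<close>, and bounding \<open>ln 2\<close> below by \<open>1 / 2\<close> then
      doubles it to \<open>16 * r\<close>.\<close>
    also have "\<dots> \<le> C * exp (4 * r) ^ (2 * n)"
    proof (intro mult_left_mono power_mono)
      have "(1 + 5 * r) / (1 + r) \<le> 1 + 4 * r"
        using r by (simp add: field_simps)
      also have "\<dots> \<le> exp (4 * r)" by simp
      finally show "(1 + 5 * r) / (1 + r) \<le> exp (4 * r)" .
    qed (use r C in auto)
    finally have "ln (2 ^ m') \<le> ln (C * exp (4 * r) ^ (2 * n))"
      using C by (subst ln_le_cancel_iff) auto
    also have "\<dots> = ln C + 8 * r * real n"
      using C by (simp add: ln_mult ln_realpow)
    also have "ln (2 ^ m') = real m' * ln 2"
      by (simp add: ln_realpow)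
    finally have "real m' * ln 2 \<le> ln C + 8 * r * real n" .
    moreover have "real m' * (1 / 2) \<le> real m' * ln 2"
      using ln2_ge_two_thirds by (intro mult_left_mono) auto
    ultimately have "real m' \<le> 2 * ln C + 16 * r * real n" by linarith
    also have "\<dots> \<le> 17 * r * real n" using elim(2) by simp
    also have "\<dots> \<le> \<epsilon> * real n" using r by (intro mult_right_mono) auto
    finally show ?case using \<open>m \<le> m'\<close> by (simp add: m_def)
  qed
  thus ?thesis using r by blast
qed

end

section \<open>Simple zeros and the count on compact intervals\<close>

text \<open>Differentiating along the circle in two ways expresses
  \<open>poly (pderiv p) (cis t)\<close> through \<open>f'\<close>, because the derivative of the
  phase is multiplied by \<open>f t = 0\<close>. A zero that is not a zero of the derivative is
  simple.\<close>

lemma order_cis_eq_1: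
  fixes p :: "complex poly" and f :: "real \<Rightarrow> real"
  assumes p: "\<And>t. poly p (cis t) = cis (m * t) * of_real (f t)"
    and f: "(f has_real_derivative f') (at t)" "f t = 0" "f' \<noteq> 0" and "p \<noteq> 0"
  shows "order (cis t) p = 1"
proof -
  have "(cis has_vector_derivative (\<i> * cis t)) (at t)"
    unfolding has_vector_derivative_def by (auto intro!: derivative_eq_intros)
  hence 1: "((\<lambda>t. poly p (cis t)) has_vector_derivative (\<i> * cis t * poly (pderiv p) (cis t))) (at t)"
    using field_vector_diff_chain_at[of cis "\<i> * cis t" t "poly p" "poly (pderiv p) (cis t)"]
    by (simp add: poly_DERIV o_def)
  have "((\<lambda>t. cis (m * t) * of_real (f t)) has_vector_derivative
          (cis (m * t) * of_real f' + (m *\<^sub>R (\<i> * cis (m * t))) * of_real (f t))) (at t)"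
  proof (rule has_vector_derivative_mult)
    show "((\<lambda>t. cis (m * t)) has_vector_derivative m *\<^sub>R (\<i> * cis (m * t))) (at t)"
      unfolding has_vector_derivative_def by (auto intro!: derivative_eq_intros simp: scaleR_conv_of_real)
    show "((\<lambda>t. complex_of_real (f t)) has_vector_derivative of_real f') (at t)"
      using f(1) by (intro has_vector_derivative_of_real) (simp add: has_real_derivative_iff_has_vector_derivative)
  qed
  hence "\<i> * cis t * poly (pderiv p) (cis t) = cis (m * t) * of_real f'"
    using 1 f(2) by (auto simp: p dest: vector_derivative_unique_at)
  hence nz: "poly (pderiv p) (cis t) \<noteq> 0"
    using f(3) by auto
  have "poly p (cis t) = 0" using p f by simp
  hence "order (cis t) p \<noteq> 0" using \<open>p \<noteq> 0\<close> by (simp add: order_root)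
  moreover have "order (cis t) (pderiv p) = 0" using nz by (rule order_0I)
  ultimately show ?thesis
    using nz \<open>poly p (cis t) = 0\<close> \<open>p \<noteq> 0\<close> by (metis One_nat_def order_pderiv order_root poly_0)
qed

lemma inj_on_cis: "inj_on cis {0..<2 * pi}"
proof (rule inj_onI)
  fix s t assume "s \<in> {0..<2 * pi}" "t \<in> {0..<2 * pi}" "cis s = cis t"
  thus "s = t"
    using Arg2pi_unique[of 1 s "cis s"] Arg2pi_unique[of 1 t "cis s"] by (auto simp: cis_conv_exp)
qed

context reciprocal_family
begin

definition \<beta>' :: "real \<Rightarrow> real" where
  "\<beta>' t = (\<Sum>j=0..l. of_int (b j) * (- sin ((real j - real l / 2) * t) * (real j - real l / 2)))"

definition \<alpha>' :: "real \<Rightarrow> real" where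
  "\<alpha>' t = (\<Sum>j=1..k. of_int (a j) * (2 * (- sin (real j * t) * real j)))"

lemma DERIV_\<beta>: "(\<beta> has_real_derivative \<beta>' t) (at t within T)"
  unfolding \<beta>_def \<beta>'_def by (auto intro!: derivative_eq_intros sum.cong)

lemma DERIV_\<alpha>: "(\<alpha> has_real_derivative \<alpha>' t) (at t within T)"
  unfolding \<alpha>_def \<alpha>'_def by (auto intro!: derivative_eq_intros sum.cong)

lemma continuous_on_\<alpha>_\<beta>:
  "continuous_on T \<alpha>" "continuous_on T \<beta>" "continuous_on T \<alpha>'" "continuous_on T \<beta>'"
  unfolding \<alpha>_def[abs_def] \<beta>_def[abs_def] \<alpha>'_def[abs_def] \<beta>'_def[abs_def]
  by (auto intro!: continuous_intros)

lemma degree_p: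
  assumes "k < n + l" "0 < n"
  shows "degree (p n) = 2 * n + 2 * l"
  using recip_poly_props(1)[of k n l b "recip_poly a b k l n" a] b_top assms
  by (simp add: p_def degree_map_poly poly_recip_poly)

lemma p_nonzero:
  assumes "k < n + l" "0 < n"
  shows "p n \<noteq> 0"
  using degree_p[OF assms] assms by auto

text \<open>Half-open arcs make adjacent counts additive and let \<open>{0..<2 * pi}\<close> cover
  the circle exactly once.\<close>

definition zeros :: "nat \<Rightarrow> real \<Rightarrow> real \<Rightarrow> real" where
  "zeros n c d = real (size {#z \<in># proots (p n). z \<in> cis ` {c..<d}#})"

text \<open>Division by \<open>2 * \<beta> t\<close>, nonzero here, leaves
  \<open>cos (N * t) + g t\<close>. Compactness gives one bound \<open>q < 1\<close> and one
  Lipschitz constant \<open>M\<close> for all \<open>n\<close>, so the count for the perturbed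
  cosine applies once \<open>N\<close> is large.\<close>

lemma eventually_zeros_compact_interval:
  assumes cd: "0 \<le> c" "c \<le> d" "d \<le> 2 * pi"
    and less: "\<And>t. t \<in> {c..d} \<Longrightarrow> \<bar>\<alpha> t\<bar> < 2 * \<bar>\<beta> t\<bar>"
  shows "\<forall>\<^sub>F n in sequentially. \<bar>zeros n c d - (real n + real l / 2) * (d - c) / pi\<bar> \<le> 2"
proof -
  define g where "g t = \<alpha> t / (2 * \<beta> t)" for t
  define g' where "g' t = (\<alpha>' t * (2 * \<beta> t) - \<alpha> t * (2 * \<beta>' t)) / (2 * \<beta> t)\<^sup>2" for t
  have \<beta>: "\<beta> t \<noteq> 0" if "t \<in> {c..d}" for t
    using less[OF that] by auto
  have g_less: "\<bar>g t\<bar> < 1" if "t \<in> {c..d}" for t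
    using less[OF that] by (auto simp: g_def abs_mult divide_less_eq)
  have contg: "continuous_on {c..d} g" and contg': "continuous_on {c..d} g'"
    unfolding g_def g'_def using \<beta> by (auto intro!: continuous_intros continuous_on_\<alpha>_\<beta>)
  have DERIV_g: "(g has_real_derivative g' t) (at t within T)" if "t \<in> {c..d}" for t T
    unfolding g_def g'_def
    by (rule derivative_eq_intros DERIV_\<alpha> DERIV_\<beta> refl)+ (use \<beta>[OF that] in \<open>auto simp: power2_eq_square\<close>)
  have "\<exists>x\<in>{c..d}. \<forall>t\<in>{c..d}. \<bar>g t\<bar> \<le> \<bar>g x\<bar>"
    using cd contg by (intro continuous_attains_sup) (auto intro!: continuous_intros)
  then obtain q where q: "\<And>t. t \<in> {c..d} \<Longrightarrow> \<bar>g t\<bar> \<le> q" "0 \<le> q" "q < 1"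
    using g_less by (metis abs_ge_zero)
  have "\<exists>x\<in>{c..d}. \<forall>t\<in>{c..d}. \<bar>g' t\<bar> \<le> \<bar>g' x\<bar>"
    using cd contg' by (intro continuous_attains_sup) (auto intro!: continuous_intros)
  then obtain M where M: "\<And>t. t \<in> {c..d} \<Longrightarrow> \<bar>g' t\<bar> \<le> M" by blast
  have lip: "\<bar>g s - g t\<bar> \<le> M * \<bar>s - t\<bar>" if "s \<in> {c..d}" "t \<in> {c..d}" for s t
    using field_differentiable_bound[of "{c..d}" g g' M s t] DERIV_g M that by auto
  have root: "sqrt (1 - q\<^sup>2) > 0"
    using q by (simp add: power_less_one_iff abs_square_less_1)
  have "filterlim (\<lambda>n. sqrt (1 - q\<^sup>2) * real n) at_top sequentially"
    using root by (intro filterlim_tendsto_pos_mult_at_top[OF tendsto_const] filterlim_real_sequentially)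
  hence "\<forall>\<^sub>F n in sequentially. sqrt (1 - q\<^sup>2) * real n > M"
    by (simp add: filterlim_at_top_dense)
  thus ?thesis
    using eventually_gt_at_top[of k]
  proof eventually_elim
    case (elim n)
    define N where "N = real n + real l / 2"
    have n: "k < n + l" "0 < n" using elim by auto
    have "sqrt (1 - q\<^sup>2) * real n \<le> N * sqrt (1 - q\<^sup>2)"
      using root by (simp add: N_def)
    hence N: "0 < N" "M < N * sqrt (1 - q\<^sup>2)"
      using elim n by (auto simp: N_def)
    define f where "f t = 2 * \<beta> t * cos (N * t) + \<alpha> t" for t
    have f_eq: "f t = 2 * \<beta> t * (cos (N * t) + g t)" if "t \<in> {c..d}" for t
      using \<beta>[OF that] by (simp add: f_def g_def field_simps)
    have p_f: "poly (p n) (cis t) = cis (real (n + l) * t) * of_real (f t)" for t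
      using poly_p_cis[of n t] n by (simp add: f_def N_def)
    define Z where "Z = {t \<in> {c..<d}. cos (N * t) + g t = 0}"
    have Z: "finite Z" "\<bar>real (card Z) - N * (d - c) / pi\<bar> \<le> 2"
      unfolding Z_def
      by (rule card_zeros_cos_perturbed[of c d g q M]; use cd contg q lip N in auto)+
    have simple: "order (cis t) (p n) = 1" if "t \<in> Z" for t
    proof (rule order_cis_eq_1[OF p_f])
      from that have t: "t \<in> {c..d}" and cos_t: "cos (N * t) = - g t"
        by (auto simp: Z_def)
      show "f t = 0" using f_eq[OF t] cos_t by simp
      show "p n \<noteq> 0" using p_nonzero n by blast
      show "(f has_real_derivative (2 * \<beta>' t * cos (N * t) - 2 * \<beta> t * (N * sin (N * t)) + \<alpha>' t)) (at t)"
        unfolding f_def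
        by (rule derivative_eq_intros DERIV_\<alpha> DERIV_\<beta> refl)+ (simp add: algebra_simps)
      \<comment> \<open>At a zero the cosine equals \<open>- g t\<close>, so \<open>N\<close> times
        the sine exceeds \<open>M\<close> in modulus and the derivative of
        \<open>cos (N * t) + g t\<close> cannot vanish.\<close>
      have "(g t)\<^sup>2 \<le> q\<^sup>2"
        using q(1)[OF t] by (metis abs_ge_zero power2_abs power_mono)
      hence "sqrt (1 - q\<^sup>2) \<le> sqrt ((sin (N * t))\<^sup>2)"
        by (simp add: sin_squared_eq cos_t)
      hence "N * sqrt (1 - q\<^sup>2) \<le> N * \<bar>sin (N * t)\<bar>"
        using N by simp
      hence "\<bar>g' t\<bar> < \<bar>N * sin (N * t)\<bar>"
        using N M[OF t] unfolding abs_mult by linarith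
      hence "g' t - N * sin (N * t) \<noteq> 0" by auto
      moreover have "2 * \<beta>' t * cos (N * t) - 2 * \<beta> t * (N * sin (N * t)) + \<alpha>' t
          = 2 * \<beta> t * (g' t - N * sin (N * t))"
        using \<beta>[OF t] by (simp add: cos_t g_def g'_def power2_eq_square field_simps)
      ultimately show "2 * \<beta>' t * cos (N * t) - 2 * \<beta> t * (N * sin (N * t)) + \<alpha>' t \<noteq> 0"
        using \<beta>[OF t] by simp
    qed
    define R where "R = {#z \<in># proots (p n). z \<in> cis ` {c..<d}#}"
    have "set_mset R = {z. poly (p n) z = 0 \<and> z \<in> cis ` {c..<d}}"
      using p_nonzero n by (auto simp: R_def)
    also have "\<dots> = cis ` Z"
      using \<beta> f_eq by (force simp: Z_def p_f)
    finally have R: "set_mset R = cis ` Z" .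
    have "size R = (\<Sum>z\<in>cis ` Z. count R z)"
      by (simp add: size_multiset_overloaded_eq R)
    also have "\<dots> = (\<Sum>z\<in>cis ` Z. 1)"
      using simple p_nonzero[OF n] by (intro sum.cong) (auto simp: R_def Z_def)
    also have "\<dots> = card Z"
    proof -
      have "inj_on cis Z"
        by (rule inj_on_subset[OF inj_on_cis]) (use cd in \<open>auto simp: Z_def\<close>)
      thus ?thesis by (simp add: card_image)
    qed
    finally have "zeros n c d = real (card Z)"
      by (simp add: zeros_def R_def)
    thus ?case using Z(2) by (simp add: N_def)
  qed
qed

section \<open>Limits of the zero count on arcs\<close>

lemma zeros_split:
  assumes "0 \<le> c" "c \<le> s" "s \<le> d" "d \<le> 2 * pi"
  shows "zeros n c d = zeros n c s + zeros n s d"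
proof -
  have "{c..<d} = {c..<s} \<union> {s..<d}" using assms by auto
  hence eq: "z \<in> cis ` {c..<d} \<longleftrightarrow> z \<in> cis ` {c..<s} \<or> z \<in> cis ` {s..<d}" for z
    by (simp add: image_Un)
  have "cis ` {c..<s} \<inter> cis ` {s..<d} = cis ` ({c..<s} \<inter> {s..<d})"
    using assms by (intro inj_on_image_Int[OF inj_on_cis, symmetric]) auto
  hence disj: "\<not> (z \<in> cis ` {c..<s} \<and> z \<in> cis ` {s..<d})" for z
    by auto
  show ?thesis
    unfolding zeros_def eq by (subst size_filter_mset_disj) (use disj in auto)
qed

lemma zeros_nonneg: "0 \<le> zeros n c d"
  by (simp add: zeros_def)

lemma zeros_le:
  assumes "\<And>t. c \<le> t \<Longrightarrow> t < d \<Longrightarrow> poly (p n) (cis t) = 0 \<Longrightarrow> t \<in> T"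
  shows "zeros n c d \<le> real (size {#z \<in># proots (p n). z \<in> cis ` T#})"
proof (cases "p n = 0")
  case False
  have "z \<in> cis ` T" if "z \<in># proots (p n)" "z \<in> cis ` {c..<d}" for z
    using that assms False by auto
  thus ?thesis
    unfolding zeros_def by (intro of_nat_mono size_filter_mset_mono)
qed (simp add: zeros_def)

text \<open>Strict dominance of \<open>\<alpha>\<close> excludes zeros in the open interval. The
  endpoint \<open>c\<close> may still be a zero, possibly multiple, and its multiplicity is
  controlled by the Jensen bound.\<close>

lemma zeros_limit_empty:
  assumes gt: "\<And>t. t \<in> {c<..<d} \<Longrightarrow> 2 * \<bar>\<beta> t\<bar> < \<bar>\<alpha> t\<bar>"
  shows "(\<lambda>n. zeros n c d / real n) \<longlonglongrightarrow> 0"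
proof (rule tendstoI)
  fix \<epsilon> :: real assume "\<epsilon> > 0"
  then obtain \<delta> where "\<delta> > 0" and ev: "\<forall>\<^sub>F n in sequentially.
      real (size {#z \<in># proots (p n). z \<in> cis ` {c - \<delta>..c + \<delta>}#}) \<le> \<epsilon> / 2 * real n"
    using eventually_zeros_near_point_le[of "\<epsilon> / 2" c] by auto
  show "\<forall>\<^sub>F n in sequentially. dist (zeros n c d / real n) 0 < \<epsilon>"
    using ev eventually_gt_at_top[of k]
  proof eventually_elim
    case (elim n)
    have "zeros n c d \<le> real (size {#z \<in># proots (p n). z \<in> cis ` {c - \<delta>..c + \<delta>}#})"
    proof (rule zeros_le)
      fix t assume t: "c \<le> t" "t < d" "poly (p n) (cis t) = 0"
      have "t = c"
      proof (rule ccontr)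
        assume "t \<noteq> c"
        hence "2 * \<bar>\<beta> t\<bar> < \<bar>\<alpha> t\<bar>" using t gt[of t] by auto
        moreover have "2 * \<beta> t * cos ((real n + real l / 2) * t) + \<alpha> t = 0"
          using t(3) elim by (subst (asm) poly_p_cis) (auto simp flip: of_real_add of_real_mult)
        hence "\<bar>\<alpha> t\<bar> = 2 * \<bar>\<beta> t\<bar> * \<bar>cos ((real n + real l / 2) * t)\<bar>"
          by (metis abs_minus_cancel abs_mult abs_numeral add.commute eq_neg_iff_add_eq_0)
        hence "\<bar>\<alpha> t\<bar> \<le> 2 * \<bar>\<beta> t\<bar>"
          by (simp add: mult_left_le)
        ultimately show False by simp
      qed
      thus "t \<in> {c - \<delta>..c + \<delta>}" using \<open>\<delta> > 0\<close> by simp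
    qed
    with elim have "zeros n c d \<le> \<epsilon> / 2 * real n" by simp
    moreover have "real n > 0" using elim by simp
    ultimately have "zeros n c d / real n \<le> \<epsilon> / 2" by (simp add: divide_le_eq)
    moreover have "0 \<le> zeros n c d / real n"
      using zeros_nonneg by simp
    ultimately show ?case
      using \<open>\<epsilon> > 0\<close> unfolding dist_real_def by linarith
  qed
qed

text \<open>The strict inequality may fail at \<open>c\<close> and \<open>d\<close>, so the precise
  count is used on a slightly smaller compact interval and the Jensen bound on the two short end
  arcs.\<close>

lemma zeros_limit_full:
  assumes cd: "0 \<le> c" "c < d" "d \<le> 2 * pi"
    and less: "\<And>t. t \<in> {c<..<d} \<Longrightarrow> \<bar>\<alpha> t\<bar> < 2 * \<bar>\<beta> t\<bar>"
  shows "(\<lambda>n. zeros n c d / real n) \<longlonglongrightarrow> (d - c) / pi"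
proof (rule tendstoI)
  fix \<epsilon> :: real assume "\<epsilon> > 0"
  \<comment> \<open>Four errors of at most \<open>\<eta>\<close> occur: one for each end arc, one
    for the length \<open>2 * \<delta>\<close> cut off, and one for the bounded terms collected in
    \<open>C\<close>. The fifth share makes the inequality strict.\<close>
  define \<eta> where "\<eta> = \<epsilon> / 5"
  have "\<eta> > 0" using \<open>\<epsilon> > 0\<close> by (simp add: \<eta>_def)
  obtain \<delta>1 where \<delta>1: "\<delta>1 > 0" and ev1: "\<forall>\<^sub>F n in sequentially.
      real (size {#z \<in># proots (p n). z \<in> cis ` {c - \<delta>1..c + \<delta>1}#}) \<le> \<eta> * real n"
    using eventually_zeros_near_point_le[OF \<open>\<eta> > 0\<close>, of c] by auto
  obtain \<delta>2 where \<delta>2: "\<delta>2 > 0" and ev2: "\<forall>\<^sub>F n in sequentially.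
      real (size {#z \<in># proots (p n). z \<in> cis ` {d - \<delta>2..d + \<delta>2}#}) \<le> \<eta> * real n"
    using eventually_zeros_near_point_le[OF \<open>\<eta> > 0\<close>, of d] by auto
  define \<delta> where "\<delta> = min (min \<delta>1 \<delta>2) (min \<eta> ((d - c) / 3))"
  have \<delta>: "\<delta> > 0" "\<delta> \<le> \<delta>1" "\<delta> \<le> \<delta>2" "\<delta> \<le> \<eta>" "\<delta> \<le> (d - c) / 3"
    using \<delta>1 \<delta>2 \<open>\<eta> > 0\<close> cd
    by (auto simp: \<delta>_def min_le_iff_disj simp del: le_divide_eq_numeral1)
  define c' where "c' = c + \<delta>"
  define d' where "d' = d - \<delta>"
  have c'd': "c < c'" "c' < d'" "d' < d"
    using \<delta> cd by (auto simp: c'_def d'_def)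
  have ev3: "\<forall>\<^sub>F n in sequentially.
      \<bar>zeros n c' d' - (real n + real l / 2) * (d' - c') / pi\<bar> \<le> 2"
    using c'd' cd by (intro eventually_zeros_compact_interval less) auto
  define C where "C = 2 + real l / 2 * (d' - c') / pi"
  have "filterlim (\<lambda>n. \<eta> * real n) at_top sequentially"
    using \<open>\<eta> > 0\<close> by (intro filterlim_tendsto_pos_mult_at_top[OF tendsto_const] filterlim_real_sequentially)
  hence ev4: "\<forall>\<^sub>F n in sequentially. C \<le> \<eta> * real n"
    by (simp add: filterlim_at_top)
  show "\<forall>\<^sub>F n in sequentially. dist (zeros n c d / real n) ((d - c) / pi) < \<epsilon>"
    using ev1 ev2 ev3 ev4 eventually_gt_at_top[of 0]
  proof eventually_elim
    case (elim n)
    have "zeros n c c' \<le> \<eta> * real n"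
      using elim(1) \<delta> by (intro order.trans[OF zeros_le elim(1)]) (auto simp: c'_def)
    moreover have "zeros n d' d \<le> \<eta> * real n"
      using elim(2) \<delta> by (intro order.trans[OF zeros_le elim(2)]) (auto simp: d'_def)
    moreover have "zeros n c d = zeros n c c' + zeros n c' d' + zeros n d' d"
      using zeros_split[of c c' d n] zeros_split[of c' d' d n] c'd' cd by simp
    moreover have "(real n + real l / 2) * (d' - c') / pi
        = real n * ((d - c) / pi) + (C - 2) - 2 * \<delta> / pi * real n"
      by (simp add: C_def c'_def d'_def field_simps)
    moreover have "2 * \<delta> / pi * real n \<le> \<eta> * real n"
    proof (rule mult_right_mono)
      have "2 * \<delta> / pi \<le> \<delta>" using \<delta> pi_gt3 by (simp add: divide_le_eq)
      thus "2 * \<delta> / pi \<le> \<eta>" using \<delta> by simp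
    qed simp
    moreover have "0 \<le> 2 * \<delta> / pi * real n" using \<delta> by simp
    moreover have "0 \<le> C - 2" using c'd' by (simp add: C_def)
    ultimately have "\<bar>zeros n c d - real n * ((d - c) / pi)\<bar> \<le> 4 * (\<eta> * real n)"
      using elim(3,4) zeros_nonneg[of n c c'] zeros_nonneg[of n d' d] unfolding abs_le_iff by linarith
    moreover have "zeros n c d / real n - (d - c) / pi = (zeros n c d - real n * ((d - c) / pi)) / real n"
      using elim(5) by (simp add: field_simps)
    ultimately have "\<bar>zeros n c d / real n - (d - c) / pi\<bar> \<le> 4 * \<eta>"
      using elim(5) by (simp only: abs_divide) (simp add: divide_le_eq mult_ac)
    thus ?case using \<open>\<epsilon> > 0\<close> by (simp add: dist_real_def \<eta>_def)
  qed
qed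

text \<open>The interval is cut at interior zeros of \<open>D\<close> until none remain; continuity
  then fixes the sign of \<open>\<alpha>\<^sup>2 - 4 * \<beta>\<^sup>2\<close> on each open piece,
  which decides between the two limits above.\<close>

lemma convergent_zeros:
  assumes "D \<noteq> 0" "0 \<le> c" "c \<le> d" "d \<le> 2 * pi"
  shows "convergent (\<lambda>n. zeros n c d / real n)"
  using assms(2-)
proof (induction "card {t \<in> {c<..<d}. poly D (cis t) = 0}" arbitrary: c d rule: less_induct)
  case (less c d)
  define S where "S c d = {t \<in> {c<..<d}. poly D (cis t) = 0}" for c d
  have fin: "finite (S c d)"
  proof (rule finite_imageD)
    show "finite (cis ` S c d)"
      by (rule finite_subset[OF _ poly_roots_finite[OF assms(1)]]) (auto simp: S_def)
    show "inj_on cis (S c d)"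
      by (rule inj_on_subset[OF inj_on_cis]) (use less.prems in \<open>auto simp: S_def\<close>)
  qed
  show ?case
  proof (cases "S c d = {}")
    case False
    then obtain s where s: "s \<in> S c d" by blast
    \<comment> \<open>The intervals are open, so the cutting point \<open>s\<close> belongs to
      neither part and both inclusions are strict.\<close>
    hence sub: "S c s \<subset> S c d" "S s d \<subset> S c d" by (auto simp: S_def)
    have "convergent (\<lambda>n. zeros n c s / real n)" "convergent (\<lambda>n. zeros n s d / real n)"
      using psubset_card_mono[OF fin sub(1)] psubset_card_mono[OF fin sub(2)] s less.prems
      by (auto intro!: less.hyps simp: S_def)
    hence "convergent (\<lambda>n. zeros n c s / real n + zeros n s d / real n)"
      by (rule convergent_add)
    moreover have "zeros n c d / real n = zeros n c s / real n + zeros n s d / real n" for n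
      using zeros_split[of c s d n] s less.prems by (auto simp: S_def add_divide_distrib)
    ultimately show ?thesis by simp
  next
    case True
    define h where "h t = (\<alpha> t)\<^sup>2 - (2 * \<beta> t)\<^sup>2" for t
    have nz: "h t \<noteq> 0" if "t \<in> {c<..<d}" for t
    proof -
      have "poly D (cis t) \<noteq> 0" using True that by (auto simp: S_def)
      thus ?thesis unfolding poly_D_cis h_def by (metis mult_zero_right of_real_0)
    qed
    have conn: "connected (h ` {c<..<d})"
      by (intro connected_continuous_image)
        (auto simp: h_def intro!: continuous_intros continuous_on_\<alpha>_\<beta>)
    consider "c = d" | "c < d" "\<forall>t\<in>{c<..<d}. h t > 0" | "c < d" "\<forall>t\<in>{c<..<d}. h t < 0"
    proof -
      have "(\<forall>t\<in>{c<..<d}. h t > 0) \<or> (\<forall>t\<in>{c<..<d}. h t < 0)"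
      proof (rule ccontr)
        assume "\<not> ?thesis"
        then obtain s t where "s \<in> {c<..<d}" "t \<in> {c<..<d}" "h s \<le> 0" "0 \<le> h t"
          by (auto simp: not_less)
        hence "0 \<in> h ` {c<..<d}"
          using connectedD_interval[OF conn, of "h s" "h t" 0] by blast
        thus False using nz by auto
      qed
      thus ?thesis using that less.prems by fastforce
    qed
    thus ?thesis
    proof cases
      case 1
      thus ?thesis by (simp add: zeros_def convergent_const)
    next
      case 2
      have "\<bar>2 * \<beta> t\<bar> < \<bar>\<alpha> t\<bar>" if "t \<in> {c<..<d}" for t
      proof -
        have "\<not> (\<alpha> t)\<^sup>2 \<le> (2 * \<beta> t)\<^sup>2" using 2(2) that by (fastforce simp: h_def)
        thus ?thesis by (simp only: abs_le_square_iff[symmetric] not_le)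
      qed
      thus ?thesis
        by (intro convergentI[where L = 0] zeros_limit_empty) (simp add: abs_mult)
    next
      case 3
      have "\<bar>\<alpha> t\<bar> < \<bar>2 * \<beta> t\<bar>" if "t \<in> {c<..<d}" for t
      proof -
        have "\<not> (2 * \<beta> t)\<^sup>2 \<le> (\<alpha> t)\<^sup>2" using 3(2) that by (fastforce simp: h_def)
        thus ?thesis by (simp only: abs_le_square_iff[symmetric] not_le)
      qed
      thus ?thesis
        using 3 less.prems by (intro convergentI[OF zeros_limit_full]) (auto simp: abs_mult)
    qed
  qed
qed

section \<open>From zeros on the circle to the fraction off it, including the degenerate
  case\<close>

text \<open>A complex polynomial has as many zeros as its degree, so the zeros off the circle are
  the complement. The quotient is split so that the limit of
  \<open>zeros n 0 (2 * pi) / real n\<close> can be inserted.\<close>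

lemma nonunimodular_frac_p:
  assumes "k < n + l" "0 < n"
  shows "nonunimodular_frac (p n) = 1 - zeros n 0 (2 * pi) / real n * (real n / real (2 * n + 2 * l))"
proof -
  have unit: "z \<in> cis ` {0..<2 * pi} \<longleftrightarrow> norm z = 1" for z
  proof
    assume "norm z = 1"
    hence "z = cis (Arg2pi z)"
      using Arg2pi_eq[of z] by (simp add: cis_conv_exp)
    thus "z \<in> cis ` {0..<2 * pi}"
      using Arg2pi_ge_0[of z] Arg2pi_lt_2pi[of z] by auto
  qed auto
  have "size (proots (p n)) = size {#z \<in># proots (p n). norm z = 1#} + size {#z \<in># proots (p n). norm z \<noteq> 1#}"
    by (subst size_filter_mset_disj[symmetric]) auto
  hence "real (2 * n + 2 * l) = zeros n 0 (2 * pi) + real (size {#z \<in># proots (p n). norm z \<noteq> 1#})"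
    unfolding zeros_def unit size_proots_complex degree_p[OF assms] by (simp only: of_nat_add)
  moreover have "x / y = 1 - z / real n * (real n / y)" if "y = z + x" "y > 0" for x y z :: real
    using that assms by (simp add: field_simps)
  ultimately show ?thesis
    unfolding nonunimodular_frac_def degree_p[OF assms] using assms by simp
qed

lemma nonunimodular_frac_le_degenerate:
  assumes "D = 0" "k < n + l" "0 < n"
  shows "nonunimodular_frac (p n) \<le> real (2 * k + 2 * l) / real n"
proof -
  \<comment> \<open>\<open>D = 0\<close> says that \<open>V\<^sup>2 = 4 * x ^ (2 * n + l) * E\<close>, so \<open>(U + V) * (U - V)\<close> is \<open>E\<close> times a square.\<close>
  define U where "U = monom 1 k * B * (monom (1::complex) (2 * n + l) + 1)"
  define V where "V = monom 1 (n + l) * A"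
  define E where "E = monom 1 (2 * k) * B\<^sup>2"
  define W where "W = (monom (1::complex) (2 * n + l) - 1)\<^sup>2"
  have eq: "monom 1 k * p n * (U - V) = E * W"
  proof -
    have m: "monom (1::complex) (2 * n + l) = monom 1 n * monom 1 n * monom 1 l"
      "monom (1::complex) (n + l) = monom 1 n * monom 1 l"
      "monom (1::complex) (2 * k) = monom 1 k * monom 1 k"
      by (simp_all add: mult_monom mult_2)
    have A2: "A * A * monom 1 l = 4 * (monom 1 k * monom 1 k * (B * B))"
      using assms(1) unfolding D_def m by (simp add: power2_eq_square numeral_poly)
    have "monom 1 k * p n * (U - V) = (U + V) * (U - V)"
      using assms by (simp add: monom_mult_p U_def V_def)
    also have "\<dots> = U * U - V * V" by (simp add: algebra_simps)
    also have "V * V = monom 1 n * monom 1 n * monom 1 l * (A * A * monom 1 l)"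
      by (simp add: V_def m mult_ac)
    also have "U * U - \<dots> = E * W"
      unfolding A2 U_def E_def W_def m power2_eq_square by (simp add: algebra_simps)
    finally show ?thesis .
  qed
  have "monom (1::complex) (2 * n + l) - 1 \<noteq> 0"
  proof
    assume "monom (1::complex) (2 * n + l) - 1 = 0"
    hence "coeff (monom (1::complex) (2 * n + l) - 1) (2 * n + l) = 0" by simp
    thus False using assms(3) by (simp add: coeff_monom)
  qed
  hence W: "W \<noteq> 0" by (simp add: W_def)
  have E: "E \<noteq> 0" using B_nonzero by (simp add: E_def monom_eq_0_iff)
  have "{#z \<in># proots W. norm z \<noteq> 1#} = {#}"
  proof -
    have "norm z = 1" if "poly W z = 0" for z
    proof -
      have "z ^ (2 * n + l) = 1" using that by (simp add: W_def poly_monom)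
      thus ?thesis using assms(3) power_eq_1_iff[of z "2 * n + l"] by auto
    qed
    hence "\<forall>z\<in>#proots W. norm z = 1" using W by simp
    thus ?thesis by (simp add: filter_mset_eq_conv)
  qed
  \<comment> \<open>\<open>p n\<close> divides the nonzero \<open>E * W\<close>, and the zeros of
    \<open>W\<close> are roots of unity. Zeros off the circle must therefore come from
    \<open>E\<close>, whose degree is bounded independently of \<open>n\<close>.\<close>
  moreover have "{#z \<in># proots (p n). norm z \<noteq> 1#} \<subseteq># {#z \<in># proots (E * W). norm z \<noteq> 1#}"
  proof (rule multiset_filter_mono)
    have "monom 1 k * p n * (U - V) \<noteq> 0" using eq E W by simp
    hence "proots (E * W) = proots (p n) + (proots (monom 1 k) + proots (U - V))"
      unfolding eq[symmetric] by (subst proots_mult | auto simp: proots_mult)+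
    thus "proots (p n) \<subseteq># proots (E * W)" by simp
  qed
  moreover have "{#z \<in># proots (E * W). norm z \<noteq> 1#}
      = {#z \<in># proots E. norm z \<noteq> 1#} + {#z \<in># proots W. norm z \<noteq> 1#}"
    using E W by (simp add: proots_mult)
  ultimately have "{#z \<in># proots (p n). norm z \<noteq> 1#} \<subseteq># {#z \<in># proots E. norm z \<noteq> 1#}"
    by (simp only: add_0_right)
  hence "size {#z \<in># proots (p n). norm z \<noteq> 1#} \<le> size {#z \<in># proots E. norm z \<noteq> 1#}"
    by (rule size_mset_mono)
  also have "\<dots> \<le> size (proots E)"
    by (intro size_mset_mono multiset_filter_subset)
  also have "\<dots> \<le> degree E" by (rule size_proots_le)
  also have "\<dots> \<le> 2 * k + 2 * l"
    unfolding E_def power2_eq_square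
    by (intro order.trans[OF degree_mult_le] add_mono degree_monom_le)
      (use degree_B in \<open>auto intro!: order.trans[OF degree_mult_le]\<close>)
  finally show ?thesis
    unfolding nonunimodular_frac_def degree_p[OF assms(2,3)] using assms(3)
    by (intro frac_le) auto
qed

text \<open>If \<open>D = 0\<close>, boundedly many zeros lie off the circle and the limit is 0.
  Otherwise about \<open>L * n\<close> of the \<open>2 * n + 2 * l\<close> zeros lie on it, and the
  limit is \<open>1 - L / 2\<close>.\<close>

theorem convergent_nonunimodular_frac_p: "convergent (\<lambda>n. nonunimodular_frac (p n))"
proof (cases "D = 0")
  case True
  have "(\<lambda>n. nonunimodular_frac (p n)) \<longlonglongrightarrow> 0"
  proof (rule tendsto_sandwich)
    show "\<forall>\<^sub>F n in sequentially. 0 \<le> nonunimodular_frac (p n)"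
      by (simp add: nonunimodular_frac_def)
    show "\<forall>\<^sub>F n in sequentially. nonunimodular_frac (p n) \<le> real (2 * k + 2 * l) / real n"
      using eventually_gt_at_top[of k]
      by eventually_elim (rule nonunimodular_frac_le_degenerate[OF True], auto)
    show "(\<lambda>n. real (2 * k + 2 * l) / real n) \<longlonglongrightarrow> 0"
      by (rule lim_const_over_n)
  qed auto
  thus ?thesis by (rule convergentI)
next
  case False
  obtain L where L: "(\<lambda>n. zeros n 0 (2 * pi) / real n) \<longlonglongrightarrow> L"
    using convergent_zeros[OF False, of 0 "2 * pi"] by (auto simp: convergent_def)
  have "(\<lambda>n. real n / real (2 * n + 2 * l)) \<longlonglongrightarrow> 1 / 2"
    by real_asymp
  hence "(\<lambda>n. 1 - zeros n 0 (2 * pi) / real n * (real n / real (2 * n + 2 * l))) \<longlonglongrightarrow> 1 - L * (1 / 2)"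
    using L by (intro tendsto_diff tendsto_mult tendsto_const)
  moreover have "\<forall>\<^sub>F n in sequentially.
      1 - zeros n 0 (2 * pi) / real n * (real n / real (2 * n + 2 * l)) = nonunimodular_frac (p n)"
    using eventually_gt_at_top[of k]
    by eventually_elim (subst nonunimodular_frac_p, auto)
  ultimately have "(\<lambda>n. nonunimodular_frac (p n)) \<longlonglongrightarrow> 1 - L * (1 / 2)"
    by (rule Lim_transform_eventually)
  thus ?thesis by (rule convergentI)
qed

end

theorem theorem2:
  fixes l k :: nat and a b :: "nat \<Rightarrow> int" and P :: "nat \<Rightarrow> int poly"
  assumes "k > 0"
    and "b l = 1"
    and "\<forall>j\<le>l. b j = b (l - j)"
    and "\<forall>n. 2 * n > k \<and> n + l \<ge> k \<longrightarrow>
           (\<forall>x::complex. x \<noteq> 0 \<longrightarrow>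
              poly (map_poly of_int (P n)) x = recip_form a b k l n x)"
  shows "convergent (\<lambda>n. nonunimodular_frac (map_poly of_int (P n)))"
proof -
  interpret reciprocal_family a b k l
    using assms(2,3) by unfold_locales blast+
  obtain L where L: "(\<lambda>n. nonunimodular_frac (p n)) \<longlonglongrightarrow> L"
    using convergent_nonunimodular_frac_p by (auto simp: convergent_def)
  \<comment> \<open>For \<open>n \<ge> k\<close> both conditions on \<open>n\<close> hold, as
    \<open>k > 0\<close> gives \<open>2 * n > k\<close>; the values away from 0 then determine
    \<open>P n\<close>.\<close>
  have "\<forall>\<^sub>F n in sequentially. nonunimodular_frac (p n) = nonunimodular_frac (map_poly of_int (P n))"
    using eventually_ge_at_top[of k]
  proof eventually_elim
    case (elim n)
    have "P n = recip_poly a b k l n"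
      using assms(1,4) elim by (intro int_poly_eqI_nonzero) (simp add: poly_recip_poly)
    thus ?case by (simp add: p_def)
  qed
  from Lim_transform_eventually[OF L this] show ?thesis by (rule convergentI)
qed

end
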